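(* Let $M\in\mathbb{R}^{2n\times 2n}$ be symmetric positive-definite with symplectic eigenvalues $d_1\le\dots\le d_n$ and let $1\le k\le n$. Let $\mathcal{I}_k=\{i_1<\dots<i_k\}\subset\{1,\dots,n\}$ and let $X\in\mathrm{Sp}(2k,2n)$ be a matrix whose columns form a normalized symplectic eigenvector set of $M$ associated with the symplectic eigenvalues $d_{i_1},\dots,d_{i_k}$. If there is at least one $i_j\in\mathcal{I}_k$ such that $d_k<d_{i_j}<d_{n-k+1}$, then $X$ is a saddle point of the problem $\min_{X\in\mathbb{R}^{2n\times 2k}} \mathrm{tr}(X^TMX)$ subject to $X^TJ_{2n}X=J_{2k}$.
   Context: Let $J_{2n}=\begin{bmatrix}0&I_n\\-I_n&0\end{bmatrix}$. $\mathrm{Sp}(2k,2n)=\{X\in\mathbb{R}^{2n\times 2k}: X^TJ_{2n}X=J_{2k}\}$ and $\mathrm{Sp}(2n)=\mathrm{Sp}(2n,2n)$. Symplectic eigenvalues: by Williamson's theorem there is $S\in\mathrm{Sp}(2n)$ with $S^TMS=\mathrm{diag}(D,D)$, $D=\mathrm{diag}(d_1,\dots,d_n)$, $0<d_1\le\dots\le d_n$; the $d_i$ (uniquely determined by $M$) are the symplectic eigenvalues of $M$, listed with multiplicity in non-decreasing order. Normalized symplectic eigenvector set: the columns of $X\in\mathbb{R}^{2n\times 2k}$ form a normalized symplectic eigenvector set of $M$ associated with the symplectic eigenvalues $\lambda_1,\dots,\lambda_k$ if $X\in\mathrm{Sp}(2k,2n)$ and $MX=J_{2n}X\begin{bmatrix}0&-\Lambda\\\Lambda&0\end{bmatrix}$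 with $\Lambda=\mathrm{diag}(\lambda_1,\dots,\lambda_k)$. Critical point: $X_*\in\mathbb{R}^{2n\times 2k}$ is a critical point of the problem if $X_*^TJ_{2n}X_*=J_{2k}$ and there is a skew-symmetric $L_*\in\mathbb{R}^{2k\times 2k}$ with $MX_*=J_{2n}X_*L_*$. A saddle point is a critical point that is neither a local minimizer nor a local maximizer of $X\mapsto\mathrm{tr}(X^TMX)$ on $\mathrm{Sp}(2k,2n)$. *)

theory Defs
  imports Complex_Main "Jordan_Normal_Form.Matrix"
begin

definition sympl_J :: "nat \<Rightarrow> real mat" where
  "sympl_J n = four_block_mat (0\<^sub>m n n) (1\<^sub>m n) (- (1\<^sub>m n)) (0\<^sub>m n n)"

text \<open>\<open>Sp k n\<close> is the symplectic Stiefel manifold usually written \<open>Sp(2k,2n)\<close>; \<open>Sp n n\<close> is the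
  symplectic group \<open>Sp(2n)\<close>.\<close>

definition Sp :: "nat \<Rightarrow> nat \<Rightarrow> real mat set" where
  "Sp k n = {X \<in> carrier_mat (2 * n) (2 * k). X\<^sup>T * sympl_J n * X = sympl_J k}"

definition sym_pos_def :: "nat \<Rightarrow> real mat \<Rightarrow> bool" where
  "sym_pos_def m M \<longleftrightarrow> M \<in> carrier_mat m m \<and> M\<^sup>T = M \<and>
     (\<forall>v \<in> carrier_vec m. v \<noteq> 0\<^sub>v m \<longrightarrow> v \<bullet> (M *\<^sub>v v) > 0)"

text \<open>Families of eigenvalues are functions on \<open>{1..n}\<close>, whereas matrix indices start at \<open>0\<close>; hence
  the shift by \<open>Suc\<close> in \<open>mat_diag\<close>. The values of a family outside \<open>{1..n}\<close> are irrelevant.\<close>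

definition symplectic_eigenvalues :: "nat \<Rightarrow> real mat \<Rightarrow> (nat \<Rightarrow> real) \<Rightarrow> bool" where
  "symplectic_eigenvalues n M d \<longleftrightarrow>
     (\<forall>i \<in> {1..n}. 0 < d i) \<and> mono_on {1..n} d \<and>
     (\<exists>S \<in> Sp n n. S\<^sup>T * M * S =
        (let D = mat_diag n (\<lambda>i. d (Suc i)) in four_block_mat D (0\<^sub>m n n) (0\<^sub>m n n) D))"

definition normalized_symplectic_eigenvector_set ::
  "nat \<Rightarrow> nat \<Rightarrow> real mat \<Rightarrow> (nat \<Rightarrow> real) \<Rightarrow> real mat \<Rightarrow> bool" where
  "normalized_symplectic_eigenvector_set k n M l X \<longleftrightarrow> X \<in> Sp k n \<and>
     M * X = sympl_J n * X *
       (let \<Lambda> = mat_diag k (\<lambda>j. l (Suc j)) in four_block_mat (0\<^sub>m k k) (- \<Lambda>) \<Lambda> (0\<^sub>m k k))"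

definition mat_trace :: "real mat \<Rightarrow> real" where
  "mat_trace A = (\<Sum>i<dim_row A. A $$ (i, i))"

definition trace_cost :: "real mat \<Rightarrow> real mat \<Rightarrow> real" where
  "trace_cost M X = mat_trace (X\<^sup>T * M * X)"

text \<open>The Frobenius distance, meant for matrices of equal dimensions; it induces the usual topology
  on each space of real matrices of fixed size.\<close>

definition frob_dist :: "real mat \<Rightarrow> real mat \<Rightarrow> real" where
  "frob_dist A B = sqrt (\<Sum>i<dim_row A. \<Sum>j<dim_col A. (A $$ (i, j) - B $$ (i, j))\<^sup>2)"

definition local_minimizer_on :: "real mat set \<Rightarrow> (real mat \<Rightarrow> real) \<Rightarrow> real mat \<Rightarrow> bool" where
  "local_minimizer_on A f X \<longleftrightarrow> X \<in> A \<and> (\<exists>\<epsilon>>0. \<forall>Y \<in> A. frob_dist X Y < \<epsilon> \<longrightarrow> f X \<le> f Y)"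

definition local_maximizer_on :: "real mat set \<Rightarrow> (real mat \<Rightarrow> real) \<Rightarrow> real mat \<Rightarrow> bool" where
  "local_maximizer_on A f X \<longleftrightarrow> X \<in> A \<and> (\<exists>\<epsilon>>0. \<forall>Y \<in> A. frob_dist X Y < \<epsilon> \<longrightarrow> f Y \<le> f X)"

text \<open>\<open>L\<close> is the Lagrange multiplier of the constraint \<open>X\<^sup>T J X = J\<close>.\<close>

definition critical_point :: "nat \<Rightarrow> nat \<Rightarrow> real mat \<Rightarrow> real mat \<Rightarrow> bool" where
  "critical_point k n M X \<longleftrightarrow> X \<in> Sp k n \<and>
     (\<exists>L \<in> carrier_mat (2 * k) (2 * k). L\<^sup>T = - L \<and> M * X = sympl_J n * X * L)"

definition saddle_point :: "nat \<Rightarrow> nat \<Rightarrow> real mat \<Rightarrow> real mat \<Rightarrow> bool" where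
  "saddle_point k n M X \<longleftrightarrow> critical_point k n M X \<and>
     \<not> local_minimizer_on (Sp k n) (trace_cost M) X \<and>
     \<not> local_maximizer_on (Sp k n) (trace_cost M) X"

end

theory Submission
  imports Defs "Jordan_Normal_Form.Determinant"
begin

text \<open>Let \<open>\<lambda> = d\<^bsub>i j\<^esub>\<close> and let \<open>(x, y)\<close> be the corresponding pair of columns of \<open>X\<close>. If \<open>u, v\<close> satisfy
  \<open>u\<^sup>T J v = 1\<close> and \<open>X\<^sup>T J u = X\<^sup>T J v = 0\<close>, then replacing \<open>(x, y)\<close> by \<open>cos t (x, y) + sin t (u, v)\<close> stays
  in the symplectic Stiefel manifold and changes the cost by \<open>sin\<^sup>2 t (u\<^sup>T M u + v\<^sup>T M v - 2 \<lambda>)\<close>, because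
  \<open>X\<^sup>T M\<close> is a multiple of \<open>X\<^sup>T J\<close>. It remains to find such \<open>u, v\<close> with
  \<open>u\<^sup>T M u + v\<^sup>T M v \<le> 2 d\<^sub>k\<close>, or \<open>\<ge> 2 d\<^bsub>n-k+1\<^esub>\<close> for the other half. Let \<open>T\<close> consist of the \<open>k\<close>
  eigenvector pairs for the smallest (largest) symplectic eigenvalues. As \<open>\<lambda>\<close> is not one of them, two rows
  of the square matrix \<open>X\<^sup>T J T\<close> vanish; a kernel vector \<open>w\<close> yields \<open>u = T w\<close>, and \<open>v\<close> is a
  multiple of \<open>J\<^sup>-\<^sup>1 M u\<close>.\<close>

section \<open>The standard symplectic matrix and the skew multiplier\<close>

lemma sympl_J_carrier [simp]: "sympl_J n \<in> carrier_mat (2 * n) (2 * n)"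
  by (auto simp: sympl_J_def)

lemma sympl_J_dim [simp]: "dim_row (sympl_J n) = 2 * n" "dim_col (sympl_J n) = 2 * n"
  by (auto simp: sympl_J_def)

lemma sympl_J_transpose: "(sympl_J n)\<^sup>T = - sympl_J n"
  by (rule eq_matI) (auto simp: sympl_J_def)

text \<open>The diagonal of diag(\<Lambda>, \<Lambda>) as a function of a position counted from 0,
  while \<open>l\<close> is counted from 1. It makes diag(\<Lambda>, \<Lambda>) a single
  \<open>mat_diag\<close> and its quadratic form a single sum.\<close>

definition doubled :: "nat \<Rightarrow> (nat \<Rightarrow> real) \<Rightarrow> nat \<Rightarrow> real" where
  "doubled k l r = l (Suc (if r < k then r else r - k))"

text \<open>The multiplier in the normalized eigenvector equation. Being skew-symmetric, it also
  serves as the Lagrange multiplier of a critical point.\<close>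

definition skew_mat :: "nat \<Rightarrow> (nat \<Rightarrow> real) \<Rightarrow> real mat" where
  "skew_mat k l = (let \<Lambda> = mat_diag k (\<lambda>j. l (Suc j)) in four_block_mat (0\<^sub>m k k) (- \<Lambda>) \<Lambda> (0\<^sub>m k k))"

lemma skew_mat_carrier [simp]: "skew_mat k l \<in> carrier_mat (2 * k) (2 * k)"
  by (auto simp: skew_mat_def Let_def mat_diag_def)

lemma skew_mat_dim [simp]: "dim_row (skew_mat k l) = 2 * k" "dim_col (skew_mat k l) = 2 * k"
  by (auto simp: skew_mat_def Let_def mat_diag_def)

lemma skew_mat_transpose: "(skew_mat k l)\<^sup>T = - skew_mat k l"
  by (rule eq_matI) (auto simp: skew_mat_def Let_def mat_diag_def)

lemma doubled_diag:
  "(let D = mat_diag k (\<lambda>i. l (Suc i)) in four_block_mat D (0\<^sub>m k k) (0\<^sub>m k k) D)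
    = mat_diag (2 * k) (doubled k l)"
  by (rule eq_matI) (auto simp: Let_def mat_diag_def doubled_def)

lemma mult_skew_block:
  fixes A B :: "real mat"
  assumes "A \<in> carrier_mat k k" "B \<in> carrier_mat k k" "C \<in> carrier_mat k k" "D \<in> carrier_mat k k"
  shows "four_block_mat (0\<^sub>m k k) A B (0\<^sub>m k k) * four_block_mat (0\<^sub>m k k) C D (0\<^sub>m k k)
    = four_block_mat (A * D) (0\<^sub>m k k) (0\<^sub>m k k) (B * C)"
  using assms by (subst mult_four_block_mat[of _ k k _ k _ k]) auto

lemma uminus_mat_diag: "- mat_diag k f = mat_diag k (\<lambda>i. - f i :: real)"
  by (rule eq_matI) (auto simp: mat_diag_def)

lemma one_mat_diag: "1\<^sub>m k = mat_diag k (\<lambda>i. 1 :: real)"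
  by simp

lemma sympl_J_mult_skew: "sympl_J k * skew_mat k l = mat_diag (2 * k) (doubled k l)"
  unfolding sympl_J_def skew_mat_def Let_def doubled_diag[symmetric]
  by (subst mult_skew_block) (auto simp: one_mat_diag uminus_mat_diag simp del: mat_diag_one)

lemma skew_mult_sympl_J: "skew_mat k l * sympl_J k = mat_diag (2 * k) (\<lambda>r. doubled k l r)"
  unfolding sympl_J_def skew_mat_def Let_def doubled_diag[symmetric]
  by (subst mult_skew_block) (auto simp: one_mat_diag uminus_mat_diag simp del: mat_diag_one)

lemma skew_mult_skew: "skew_mat k l * skew_mat k l = mat_diag (2 * k) (\<lambda>r. - (doubled k l r)\<^sup>2)"
proof -
  have "(\<lambda>r. - (doubled k l r)\<^sup>2) = doubled k (\<lambda>j. - (l j)\<^sup>2)"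
    by (auto simp: doubled_def)
  then show ?thesis
    unfolding skew_mat_def Let_def doubled_diag[symmetric]
    by (auto simp: mult_skew_block uminus_mat_diag power2_eq_square
        doubled_diag[of k "\<lambda>j. - (l j * l j)", unfolded Let_def, symmetric])
qed

text \<open>With N the skew multiplier, replacing the diagonal by J N regroups the product as -(N
  J)(N N), a product of two diagonal matrices. It gives the cost of a vector of the form T N
  w.\<close>

lemma skew_congruence_diag:
  "(skew_mat k l)\<^sup>T * mat_diag (2 * k) (doubled k l) * skew_mat k l
    = mat_diag (2 * k) (\<lambda>r. (doubled k l r) ^ 3)"
proof -
  let ?N = "skew_mat k l" and ?J = "sympl_J k"
  have "?N\<^sup>T * mat_diag (2 * k) (doubled k l) * ?N = ?N\<^sup>T * (?J * ?N) * ?N"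
    by (simp add: sympl_J_mult_skew)
  also have "\<dots> = - ((?N * ?J) * (?N * ?N))"
    by (simp add: skew_mat_transpose assoc_mult_mat[of _ "2*k" "2*k" _ "2*k" _ "2*k"]
        mult_carrier_mat[of _ "2*k" "2*k"])
  also have "\<dots> = mat_diag (2 * k) (\<lambda>r. (doubled k l r) ^ 3)"
    by (simp add: skew_mult_sympl_J skew_mult_skew uminus_mat_diag power2_eq_square power3_eq_cube
        mult.assoc)
  finally show ?thesis .
qed

text \<open>Applying the equation twice gives N^2 G = G N'^2. Both squares are diagonal, so the
  equation decouples into one scalar equation per entry.\<close>

lemma skew_sylvester_zero:
  assumes G: "G \<in> carrier_mat (2 * k) (2 * m)"
    and eq: "skew_mat k l * G = G * skew_mat m l'"
    and r: "r < 2 * k" and c: "c < 2 * m"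
    and ne: "(doubled k l r)\<^sup>2 \<noteq> (doubled m l' c)\<^sup>2"
  shows "G $$ (r, c) = 0"
proof -
  let ?N = "skew_mat k l" and ?N' = "skew_mat m l'"
  have "?N * ?N * G = ?N * (G * ?N')"
    using G by (simp add: eq assoc_mult_mat[of _ "2*k" "2*k" _ "2*k" _ "2*m"])
  also have "\<dots> = ?N * G * ?N'"
    using G by (simp add: assoc_mult_mat[of _ "2*k" "2*k" _ "2*m" _ "2*m"])
  also have "\<dots> = G * (?N' * ?N')"
    using G by (simp add: eq assoc_mult_mat[of _ "2*k" "2*m" _ "2*m" _ "2*m"])
  finally have "mat_diag (2 * k) (\<lambda>r. - (doubled k l r)\<^sup>2) * G
      = G * mat_diag (2 * m) (\<lambda>r. - (doubled m l' r)\<^sup>2)"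
    by (simp add: skew_mult_skew)
  then have "mat (2 * k) (2 * m) (\<lambda>(i, j). - (doubled k l i)\<^sup>2 * G $$ (i, j)) $$ (r, c)
      = mat (2 * k) (2 * m) (\<lambda>(i, j). G $$ (i, j) * - (doubled m l' j)\<^sup>2) $$ (r, c)"
    using mat_diag_mult_left[OF G] mat_diag_mult_right[OF G] by simp
  then have "((doubled k l r)\<^sup>2 - (doubled m l' c)\<^sup>2) * G $$ (r, c) = 0"
    using r c by (simp add: algebra_simps)
  then show ?thesis using ne by simp
qed

section \<open>Quadratic forms under congruence\<close>

lemma scalar_prod_mat_diag:
  fixes w :: "real vec"
  assumes "w \<in> carrier_vec m"
  shows "w \<bullet> (mat_diag m f *\<^sub>v w) = (\<Sum>r<m. f r * (w $ r)\<^sup>2)"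
proof -
  have "(mat_diag m f *\<^sub>v w) $ r = f r * w $ r" if "r < m" for r
  proof -
    have "(mat_diag m f *\<^sub>v w) $ r = (\<Sum>i = 0..<m. (if r = i then f i else 0) * w $ i)"
      using assms that by (simp add: mat_diag_def scalar_prod_def)
    also have "\<dots> = (\<Sum>i = 0..<m. if r = i then f i * w $ i else 0)"
      by (intro sum.cong) auto
    finally show ?thesis using that by simp
  qed
  then show ?thesis
    using assms by (auto simp: scalar_prod_def mat_diag_def lessThan_atLeast0 power2_eq_square
        intro!: sum.cong)
qed

lemma scalar_prod_congruence:
  fixes A B :: "real mat"
  assumes A: "A \<in> carrier_mat m p" and B: "B \<in> carrier_mat m m"
    and x: "x \<in> carrier_vec p" and y: "y \<in> carrier_vec p"
  shows "(A *\<^sub>v x) \<bullet> (B *\<^sub>v (A *\<^sub>v y)) = x \<bullet> ((A\<^sup>T * B * A) *\<^sub>v y)"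
proof -
  have "(A *\<^sub>v x) \<bullet> (B *\<^sub>v (A *\<^sub>v y)) = (B *\<^sub>v (A *\<^sub>v y)) \<bullet> (A *\<^sub>v x)"
    using A B x y by (intro comm_scalar_prod[of _ m]) auto
  also have "\<dots> = (A\<^sup>T *\<^sub>v (B *\<^sub>v (A *\<^sub>v y))) \<bullet> x"
    using A B x y by (subst transpose_vec_mult_scalar[of A m p]) auto
  also have "\<dots> = x \<bullet> (A\<^sup>T *\<^sub>v (B *\<^sub>v (A *\<^sub>v y)))"
    using A B x y by (intro comm_scalar_prod[of _ p]) auto
  also have "A\<^sup>T *\<^sub>v (B *\<^sub>v (A *\<^sub>v y)) = (A\<^sup>T * B * A) *\<^sub>v y"
    using A B x y by (simp add: assoc_mult_mat_vec[of _ p m _ p] assoc_mult_mat_vec[of _ p m _ m])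
  finally show ?thesis .
qed

lemma congruence_entry:
  fixes A Y :: "real mat"
  assumes "Y \<in> carrier_mat m p" "A \<in> carrier_mat m m" "i < p" "j < p"
  shows "(Y\<^sup>T * A * Y) $$ (i, j) = col Y i \<bullet> (A *\<^sub>v col Y j)"
proof -
  have "(Y\<^sup>T * A * Y) $$ (i, j) = (Y\<^sup>T * (A * Y)) $$ (i, j)"
    using assms by (simp add: assoc_mult_mat[of _ p m _ m _ p])
  also have "\<dots> = col Y i \<bullet> col (A * Y) j"
    using assms by simp
  also have "col (A * Y) j = A *\<^sub>v col Y j"
    using assms by (intro col_mult2[of _ m m _ p]) auto
  finally show ?thesis .
qed

section \<open>Normalized symplectic eigenvector sets\<close>

lemma normalized_set_iff:
  "normalized_symplectic_eigenvector_set k n M l X \<longleftrightarrow>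
    X \<in> Sp k n \<and> M * X = sympl_J n * X * skew_mat k l"
  by (simp add: normalized_symplectic_eigenvector_set_def skew_mat_def)

text \<open>Inserting the eigenvector equation for \<open>M * X\<close> leaves
  \<open>X\<^sup>T * sympl_J n * X = sympl_J k\<close> times the multiplier, which is
  diagonal.\<close>

lemma normalized_set_congruence:
  assumes "M \<in> carrier_mat (2 * n) (2 * n)"
    and "normalized_symplectic_eigenvector_set k n M l X"
  shows "X\<^sup>T * M * X = mat_diag (2 * k) (doubled k l)"
proof -
  have X: "X \<in> carrier_mat (2 * n) (2 * k)" and J: "X\<^sup>T * sympl_J n * X = sympl_J k"
    and MX: "M * X = sympl_J n * X * skew_mat k l"
    using assms(2) by (auto simp: normalized_set_iff Sp_def)
  have "X\<^sup>T * M * X = X\<^sup>T * (M * X)"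
    using assms(1) X by (simp add: assoc_mult_mat[of _ "2*k" "2*n" _ "2*n" _ "2*k"])
  also have "\<dots> = X\<^sup>T * (sympl_J n * X) * skew_mat k l"
    using X unfolding MX by (subst assoc_mult_mat[of _ "2*k" "2*n" _ "2*k" _ "2*k"]) auto
  also have "X\<^sup>T * (sympl_J n * X) = sympl_J k"
    using J X by (simp add: assoc_mult_mat[of _ "2*k" "2*n" _ "2*n" _ "2*k"])
  finally show ?thesis by (simp add: sympl_J_mult_skew)
qed

text \<open>Transpose of the eigenvector equation; J and the multiplier are both skew, so the two
  signs cancel. Consequently a vector J-orthogonal to the columns of \<open>X\<close> is also
  M-orthogonal to them.\<close>

lemma normalized_set_left:
  assumes M: "M \<in> carrier_mat (2 * n) (2 * n)" "M\<^sup>T = M"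
    and X: "normalized_symplectic_eigenvector_set k n M l X"
  shows "X\<^sup>T * M = skew_mat k l * (X\<^sup>T * sympl_J n)"
proof -
  have Xc: "X \<in> carrier_mat (2 * n) (2 * k)" and MX: "M * X = sympl_J n * X * skew_mat k l"
    using X by (auto simp: normalized_set_iff Sp_def)
  have "X\<^sup>T * M = (M * X)\<^sup>T"
    using M Xc by (simp add: transpose_mult[of _ "2*n" "2*n" _ "2*k"])
  also have "\<dots> = - skew_mat k l * (X\<^sup>T * - sympl_J n)"
    unfolding MX using Xc
    by (simp add: transpose_mult[of _ "2*n" "2*k" _ "2*k"] transpose_mult[of _ "2*n" "2*n" _ "2*k"]
        mult_carrier_mat[of _ "2*n" "2*n"]
        skew_mat_transpose sympl_J_transpose)
  also have "\<dots> = skew_mat k l * (X\<^sup>T * sympl_J n)"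
    using Xc by simp
  finally show ?thesis .
qed

text \<open>Since \<open>S\<close> is symplectic, the inverse of \<open>S\<^sup>T\<close> is J S
  (-J). Multiplying the Williamson form J N by it yields M S = J S (-J) J N = J S N.\<close>

lemma normalized_set_of_williamson:
  assumes M: "M \<in> carrier_mat (2 * n) (2 * n)" and S: "S \<in> Sp n n"
    and diag: "S\<^sup>T * M * S = mat_diag (2 * n) (doubled n d)"
  shows "normalized_symplectic_eigenvector_set n n M d S"
proof -
  let ?J = "sympl_J n"
  note assoc = assoc_mult_mat[of _ "2*n" "2*n" _ "2*n" _ "2*n"] mult_carrier_mat[of _ "2*n" "2*n" _ "2*n"]
  have Sc: "S \<in> carrier_mat (2 * n) (2 * n)" and SJ: "S\<^sup>T * ?J * S = ?J"
    using S by (auto simp: Sp_def)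
  have JJ: "?J * - ?J = 1\<^sub>m (2 * n)"
    unfolding one_mat_diag sympl_J_def
    by (rule eq_matI) (auto simp: mat_diag_def mult_skew_block)
  have "S\<^sup>T * (?J * S * - ?J) = S\<^sup>T * ?J * S * - ?J"
    using Sc by (simp add: assoc)
  also have "\<dots> = 1\<^sub>m (2 * n)"
    unfolding SJ by (rule JJ)
  finally have "S\<^sup>T * (?J * S * - ?J) = 1\<^sub>m (2 * n)" .
  moreover have "?J * S * - ?J \<in> carrier_mat (2 * n) (2 * n)" "S\<^sup>T \<in> carrier_mat (2 * n) (2 * n)"
    using Sc by (simp_all add: mult_carrier_mat[of _ "2*n" "2*n" _ "2*n"])
  \<comment> \<open>For square matrices a right inverse is also a left inverse.\<close>
  ultimately have "(?J * S * - ?J) * S\<^sup>T = 1\<^sub>m (2 * n)"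
    by (intro mat_mult_left_right_inverse[of "S\<^sup>T" "2*n"])
  then have "M * S = (?J * S * - ?J) * S\<^sup>T * (M * S)"
    using M Sc by (simp add: mult_carrier_mat[of _ "2*n" "2*n"])
  also have "\<dots> = ?J * S * - ?J * (S\<^sup>T * M * S)"
    using M Sc by (simp add: assoc)
  also have "\<dots> = ?J * S * (- ?J * ?J) * skew_mat n d"
    unfolding diag sympl_J_mult_skew[symmetric] using M Sc by (simp add: assoc)
  also have "- ?J * ?J = 1\<^sub>m (2 * n)"
    using JJ by simp
  also have "?J * S * 1\<^sub>m (2 * n) = ?J * S"
    using Sc by (simp add: assoc)
  finally show ?thesis
    using S by (simp add: normalized_set_iff)
qed

definition selection_mat :: "nat \<Rightarrow> nat \<Rightarrow> (nat \<Rightarrow> nat) \<Rightarrow> real mat" where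
  "selection_mat n k h = mat n k (\<lambda>(r, c). if r = h c then 1 else 0)"

lemma selection_mat_orthonormal:
  assumes "inj_on h {..<k}" "h ` {..<k} \<subseteq> {..<n}"
  shows "(selection_mat n k h)\<^sup>T * selection_mat n k h = 1\<^sub>m k"
proof (rule eq_matI)
  fix a b assume ab: "a < dim_row (1\<^sub>m k)" "b < dim_col (1\<^sub>m k)"
  then have h: "h a < n" "h a = h b \<longleftrightarrow> a = b"
    using assms by (auto simp: inj_on_def)
  have "((selection_mat n k h)\<^sup>T * selection_mat n k h) $$ (a, b)
      = (\<Sum>r = 0..<n. (if r = h a then 1 else 0) * (if r = h b then 1 else 0))"
    using ab by (simp add: selection_mat_def scalar_prod_def)
  also have "\<dots> = (\<Sum>r = 0..<n. if r = h a then (if a = b then 1 else 0) else 0)"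
    using h by (intro sum.cong) auto
  finally show "((selection_mat n k h)\<^sup>T * selection_mat n k h) $$ (a, b) = 1\<^sub>m k $$ (a, b)"
    using h ab by simp
qed (auto simp: selection_mat_def)

text \<open>Right multiplication by E = diag(F, F), with \<open>F\<close> a 0/1 selection matrix,
  picks the column pairs (h a, m + h a). Orthonormality of the columns of \<open>F\<close> makes
  \<open>E\<close> symplectic, and D F = F D' carries the eigenvector equation over. The shift
  \<open>a - 1\<close> occurs because \<open>h\<close> counts from 0.\<close>

lemma normalized_set_select:
  assumes M: "M \<in> carrier_mat (2 * n) (2 * n)"
    and S: "normalized_symplectic_eigenvector_set m n M d S"
    and h: "inj_on h {..<k}" "h ` {..<k} \<subseteq> {..<m}"
  shows "\<exists>T. normalized_symplectic_eigenvector_set k n M (\<lambda>a. d (Suc (h (a - 1)))) T"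
proof -
  let ?d' = "\<lambda>a. d (Suc (h (a - 1)))"
  define F where "F = selection_mat m k h"
  define E where "E = four_block_mat F (0\<^sub>m m k) (0\<^sub>m m k) F"
  have F: "F \<in> carrier_mat m k"
    by (simp add: F_def selection_mat_def)
  have FF: "F\<^sup>T * F = 1\<^sub>m k"
    unfolding F_def by (rule selection_mat_orthonormal) (use h in auto)
  have DF: "mat_diag m (\<lambda>j. d (Suc j)) * F = F * mat_diag k (\<lambda>j. ?d' (Suc j))"
    unfolding mat_diag_mult_left[OF F] mat_diag_mult_right[OF F]
    by (rule eq_matI) (auto simp: F_def selection_mat_def)
  have E: "E \<in> carrier_mat (2 * m) (2 * k)"
    using F by (auto simp: E_def)
  have Sc: "S \<in> carrier_mat (2 * n) (2 * m)" and SJ: "S\<^sup>T * sympl_J n * S = sympl_J m"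
    and MS: "M * S = sympl_J n * S * skew_mat m d"
    using S by (auto simp: normalized_set_iff Sp_def)
  have FT: "F\<^sup>T \<in> carrier_mat k m"
    using F by simp
  have ET: "E\<^sup>T = four_block_mat (F\<^sup>T) (0\<^sub>m k m) (0\<^sub>m k m) (F\<^sup>T)"
    unfolding E_def using F by (subst transpose_four_block_mat[of _ m k _ k _ m]) auto
  have EJ: "E\<^sup>T * sympl_J m = four_block_mat (0\<^sub>m k m) (F\<^sup>T) (- (F\<^sup>T)) (0\<^sub>m k m)"
    unfolding ET sympl_J_def using F by (subst mult_four_block_mat[of _ k m _ m _ k _ _ m _ m]) auto
  have EJE: "E\<^sup>T * sympl_J m * E = sympl_J k"
    unfolding EJ unfolding E_def sympl_J_def FF[symmetric] using F FT
    by (subst mult_four_block_mat[of _ k m _ m _ k _ _ k _ k]) auto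
  have NE: "skew_mat m d * E = E * skew_mat k ?d'"
  proof -
    let ?D = "mat_diag m (\<lambda>j. d (Suc j))" and ?D' = "mat_diag k (\<lambda>j. ?d' (Suc j))"
    have "skew_mat m d * E = four_block_mat (0\<^sub>m m k) (- (?D * F)) (?D * F) (0\<^sub>m m k)"
      unfolding skew_mat_def Let_def E_def using F
      by (subst mult_four_block_mat[of _ m m _ m _ m _ _ k _ k])
        (auto simp: mult_carrier_mat[of _ m m] mat_diag_def)
    also have "\<dots> = E * skew_mat k ?d'"
      unfolding skew_mat_def Let_def E_def DF using F
      by (subst mult_four_block_mat[of _ m k _ k _ m _ _ k _ k])
        (auto simp: mult_carrier_mat[of _ m k] mat_diag_def)
    finally show ?thesis .
  qed
  have "(S * E)\<^sup>T * sympl_J n * (S * E) = E\<^sup>T * (S\<^sup>T * sympl_J n * S) * E"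
    using Sc E by (simp add: transpose_mult[of _ "2*n" "2*m" _ "2*k"] mult_carrier_mat[of _ "2*n" "2*n"]
        mult_carrier_mat[of _ "2*n" "2*m"] mult_carrier_mat[of _ "2*m" "2*n"]
        assoc_mult_mat[of _ "2*m" "2*n" _ "2*n" _ "2*k"]
        assoc_mult_mat[of _ "2*k" "2*m" _ "2*n" _ "2*n"] assoc_mult_mat[of _ "2*k" "2*m" _ "2*n" _ "2*k"]
        assoc_mult_mat[of _ "2*k" "2*m" _ "2*m" _ "2*k"] assoc_mult_mat[of _ "2*m" "2*n" _ "2*n" _ "2*m"]
        assoc_mult_mat[of _ "2*m" "2*n" _ "2*m" _ "2*k"] assoc_mult_mat[of _ "2*n" "2*n" _ "2*m" _ "2*k"])
  then have "(S * E)\<^sup>T * sympl_J n * (S * E) = sympl_J k"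
    by (simp add: SJ EJE)
  moreover have "S * E \<in> carrier_mat (2 * n) (2 * k)"
    using Sc E by simp
  moreover have "M * (S * E) = sympl_J n * (S * E) * skew_mat k ?d'"
  proof -
    have "M * (S * E) = M * S * E"
      using M Sc E by (simp add: assoc_mult_mat[of _ "2*n" "2*n" _ "2*m" _ "2*k"])
    also have "\<dots> = sympl_J n * S * skew_mat m d * E"
      by (simp only: MS)
    also have "\<dots> = sympl_J n * S * (skew_mat m d * E)"
      using Sc E by (simp add: assoc_mult_mat[of _ "2*n" "2*m" _ "2*m" _ "2*k"] mult_carrier_mat[of _ "2*n" "2*n"])
    also have "\<dots> = sympl_J n * (S * E) * skew_mat k ?d'"
      unfolding NE using Sc E
      by (simp add: assoc_mult_mat[of _ "2*n" "2*m" _ "2*k" _ "2*k"] mult_carrier_mat[of _ "2*n" "2*n"]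
         mult_carrier_mat[of _ "2*n" "2*m"] mult_carrier_mat[of _ "2*m" "2*k"]
         assoc_mult_mat[of _ "2*n" "2*n" _ "2*m" _ "2*k"] assoc_mult_mat[of _ "2*n" "2*n" _ "2*k" _ "2*k"])
    finally show ?thesis .
  qed
  ultimately show ?thesis
    unfolding normalized_set_iff Sp_def by blast
qed


section \<open>Symplectically orthogonal directions with controlled cost\<close>

text \<open>The sign of \<open>\<sigma>\<close> selects descent (\<open>\<sigma> > 0\<close>) or ascent (\<open>\<sigma> < 0\<close>).\<close>

lemma symplectic_direction:
  assumes M: "M \<in> carrier_mat (2 * n) (2 * n)" "M\<^sup>T = M"
    and X: "normalized_symplectic_eigenvector_set k n M l X"
    and T: "normalized_symplectic_eigenvector_set k n M \<mu> T"
    and p: "p < k" "0 < l (Suc p)"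
    and \<mu>: "\<And>a. a \<in> {1..k} \<Longrightarrow> 0 < \<mu> a \<and> \<mu> a \<noteq> l (Suc p) \<and> \<sigma> * \<mu> a \<le> \<sigma> * \<delta>"
    and \<delta>: "0 < \<delta>"
  obtains u v where "u \<in> carrier_vec (2 * n)" "v \<in> carrier_vec (2 * n)"
    "X\<^sup>T *\<^sub>v (sympl_J n *\<^sub>v u) = 0\<^sub>v (2 * k)" "X\<^sup>T *\<^sub>v (sympl_J n *\<^sub>v v) = 0\<^sub>v (2 * k)"
    "u \<bullet> (sympl_J n *\<^sub>v v) = 1" "\<sigma> * (u \<bullet> (M *\<^sub>v u) + v \<bullet> (M *\<^sub>v v)) \<le> \<sigma> * (2 * \<delta>)"
proof -
  let ?J = "sympl_J n" and ?N = "skew_mat k \<mu>" and ?e = "doubled k \<mu>"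
  define G where "G = X\<^sup>T * ?J * T"
  have Xc: "X \<in> carrier_mat (2 * n) (2 * k)"
    using X by (auto simp: normalized_set_iff Sp_def)
  have Tc: "T \<in> carrier_mat (2 * n) (2 * k)" and TJ: "T\<^sup>T * ?J * T = sympl_J k"
    and MT: "M * T = ?J * T * ?N"
    using T by (auto simp: normalized_set_iff Sp_def)
  have Gc: "G \<in> carrier_mat (2 * k) (2 * k)"
    using Xc Tc by (auto simp: G_def)
  \<comment> \<open>Evaluating \<open>X\<^sup>T * M * T\<close> from the left and from the right
    yields a Sylvester equation for \<open>G\<close>.\<close>
  have "skew_mat k l * G = X\<^sup>T * M * T"
    unfolding G_def normalized_set_left[OF M X] using Xc Tc
    by (simp add: assoc_mult_mat[of _ "2*k" "2*k" _ "2*n" _ "2*k"] mult_carrier_mat[of _ "2*k" "2*n"])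
  also have "\<dots> = X\<^sup>T * (?J * T * ?N)"
    using M Xc Tc by (simp add: MT[symmetric])
  also have "\<dots> = G * ?N"
    unfolding G_def using Xc Tc
    by (simp add: assoc_mult_mat[of _ "2*k" "2*n" _ "2*n" _ "2*k"] assoc_mult_mat[of _ "2*k" "2*n" _ "2*k" _ "2*k"]
        mult_carrier_mat[of _ "2*n" "2*n"])
  finally have NG: "skew_mat k l * G = G * ?N" .
  have e: "0 < ?e r" "?e r \<noteq> l (Suc p)" "\<sigma> * ?e r \<le> \<sigma> * \<delta>" if "r < 2 * k" for r
  proof -
    have "Suc (if r < k then r else r - k) \<in> {1..k}"
      using that by auto
    from \<mu>[OF this] show "0 < ?e r" "?e r \<noteq> l (Suc p)" "\<sigma> * ?e r \<le> \<sigma> * \<delta>"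
      by (simp_all add: doubled_def)
  qed
  \<comment> \<open>The value belonging to row \<open>p\<close> is \<open>l (Suc p)\<close>. It
    differs from every \<open>?e c\<close>, and since both are positive their squares differ as
    well. One zero row makes the square matrix \<open>G\<close> singular.\<close>
  have "G $$ (p, c) = 0" if "c < 2 * k" for c
    using p e[OF that]
    by (intro skew_sylvester_zero[OF Gc NG _ that])
      (auto simp: doubled_def[of k l] power2_eq_iff)
  then have "det G = 0"
    using p by (subst laplace_expansion_row[OF Gc, of p]) auto
  then obtain w where w: "w \<in> carrier_vec (2 * k)" "w \<noteq> 0\<^sub>v (2 * k)" and Gw: "G *\<^sub>v w = 0\<^sub>v (2 * k)"
    unfolding det_0_iff_vec_prod_zero[OF Gc] by blast
  define u0 where "u0 = T *\<^sub>v w"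
  \<comment> \<open>This is the inverse of J applied to M \<open>u0\<close>, because J T N w = M T
    w.\<close>
  define v0 where "v0 = T *\<^sub>v (?N *\<^sub>v w)"
  have Nw: "?N *\<^sub>v w \<in> carrier_vec (2 * k)"
    using w by (intro mult_mat_vec_carrier[of _ "2*k" "2*k"]) auto
  have u0: "u0 \<in> carrier_vec (2 * n)" and v0: "v0 \<in> carrier_vec (2 * n)"
    using Tc w Nw by (auto simp: u0_def v0_def)
  have G_vec: "X\<^sup>T *\<^sub>v (?J *\<^sub>v (T *\<^sub>v x)) = G *\<^sub>v x" if "x \<in> carrier_vec (2 * k)" for x
    unfolding G_def using that Xc Tc
    by (simp add: assoc_mult_mat_vec[of _ "2*k" "2*n" _ "2*k"] assoc_mult_mat_vec[of _ "2*k" "2*n" _ "2*n"])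
  have Ju: "X\<^sup>T *\<^sub>v (?J *\<^sub>v u0) = 0\<^sub>v (2 * k)"
    unfolding u0_def G_vec[OF w(1)] by (rule Gw)
  \<comment> \<open>The Sylvester equation makes the kernel of \<open>G\<close> invariant under
    \<open>?N\<close>, so \<open>v0\<close> inherits the orthogonality of \<open>u0\<close>.\<close>
  have "G *\<^sub>v (?N *\<^sub>v w) = (G * ?N) *\<^sub>v w"
    using Gc w by (simp add: assoc_mult_mat_vec[of _ "2*k" "2*k" _ "2*k"])
  also have "\<dots> = skew_mat k l *\<^sub>v (G *\<^sub>v w)"
    unfolding NG[symmetric] using Gc w by (simp add: assoc_mult_mat_vec[of _ "2*k" "2*k" _ "2*k"])
  also have "\<dots> = 0\<^sub>v (2 * k)"
    unfolding Gw by (rule eq_vecI) auto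
  finally have Jv: "X\<^sup>T *\<^sub>v (?J *\<^sub>v v0) = 0\<^sub>v (2 * k)"
    unfolding v0_def G_vec[OF Nw] .
  \<comment> \<open>In the coordinates \<open>w\<close>, the cost of \<open>u0\<close> and its
    symplectic product with \<open>v0\<close> are both \<open>a\<close>, and the cost of
    \<open>v0\<close> is \<open>b\<close>.\<close>
  define a where "a = (\<Sum>r<2 * k. ?e r * (w $ r)\<^sup>2)"
  define b where "b = (\<Sum>r<2 * k. ?e r ^ 3 * (w $ r)\<^sup>2)"
  have uMu: "u0 \<bullet> (M *\<^sub>v u0) = a"
    unfolding u0_def a_def scalar_prod_congruence[OF Tc M(1) w(1) w(1)]
      normalized_set_congruence[OF M(1) T] by (rule scalar_prod_mat_diag[OF w(1)])
  have uJv: "u0 \<bullet> (?J *\<^sub>v v0) = a"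
    unfolding u0_def v0_def a_def scalar_prod_congruence[OF Tc sympl_J_carrier w(1) Nw] TJ
      assoc_mult_mat_vec[OF sympl_J_carrier skew_mat_carrier w(1), symmetric] sympl_J_mult_skew
    by (rule scalar_prod_mat_diag[OF w(1)])
  have vMv: "v0 \<bullet> (M *\<^sub>v v0) = b"
    unfolding v0_def b_def scalar_prod_congruence[OF Tc M(1) Nw Nw]
      normalized_set_congruence[OF M(1) T]
      scalar_prod_congruence[OF skew_mat_carrier mat_diag_dim w(1) w(1)] skew_congruence_diag
    by (rule scalar_prod_mat_diag[OF w(1)])
  obtain r where r: "r < 2 * k" "w $ r \<noteq> 0"
    using w by (metis carrier_vecD eq_vecI index_zero_vec)
  have a: "0 < a"
    unfolding a_def using r e(1) by (intro sum_pos2[of _ r]) (auto intro!: mult_nonneg_nonneg less_imp_le[OF e(1)])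
  have ba: "\<sigma> * b \<le> \<sigma> * (\<delta>\<^sup>2 * a)"
    unfolding a_def b_def sum_distrib_left
  proof (rule sum_mono)
    fix r assume "r \<in> {..<2 * k}"
    then have r: "0 < ?e r" "\<sigma> * ?e r \<le> \<sigma> * \<delta>"
      using e by auto
    \<comment> \<open>With e = \<open>?e r\<close>, this factorization e (e + \<delta>) (\<delta> -
      e) = \<delta>^2 e - e^3 reduces the claim for each summand to the assumed comparison of e with
      \<delta>, for either sign of \<sigma>.\<close>
    have "0 \<le> (?e r * (?e r + \<delta>) * (w $ r)\<^sup>2) * (\<sigma> * \<delta> - \<sigma> * ?e r)"
      using r \<delta> by (intro mult_nonneg_nonneg) auto
    then show "\<sigma> * (?e r ^ 3 * (w $ r)\<^sup>2) \<le> \<sigma> * (\<delta>\<^sup>2 * (?e r * (w $ r)\<^sup>2))"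
      by (simp add: algebra_simps power2_eq_square power3_eq_cube)
  qed
  \<comment> \<open>Scaling \<open>u0\<close> by \<open>s\<close> and \<open>v0\<close> by
    \<open>s / \<delta>\<close> normalizes the symplectic product to s^2 a / \<delta> = 1. The total
    cost becomes \<delta> + b / (\<delta> a), and the comparison of \<open>b\<close> with \<delta>^2
    a bounds it by 2 \<delta> in the direction given by \<sigma>.\<close>
  define s where "s = sqrt (\<delta> / a)"
  have s2: "s * s = \<delta> / a"
    using a \<delta> by (simp add: s_def)
  have "s * s / \<delta>\<^sup>2 * (\<sigma> * b) \<le> s * s / \<delta>\<^sup>2 * (\<sigma> * (\<delta>\<^sup>2 * a))"
    using ba by (rule mult_left_mono) auto
  then have le: "\<sigma> * (s * s * a + s / \<delta> * (s / \<delta>) * b) \<le> \<sigma> * (2 * \<delta>)"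
    using a \<delta> by (simp add: s2 field_simps power2_eq_square)
  show thesis
  proof (rule that[of "s \<cdot>\<^sub>v u0" "(s / \<delta>) \<cdot>\<^sub>v v0"])
    have lin: "A *\<^sub>v (t \<cdot>\<^sub>v x) = t \<cdot>\<^sub>v (A *\<^sub>v x)"
      if "A \<in> carrier_mat q (2 * n)" "x \<in> carrier_vec (2 * n)" for q t x and A :: "real mat"
      using that by (rule mult_mat_vec)
    have J0: "X\<^sup>T *\<^sub>v (?J *\<^sub>v (t \<cdot>\<^sub>v x)) = t \<cdot>\<^sub>v (X\<^sup>T *\<^sub>v (?J *\<^sub>v x))"
      if "x \<in> carrier_vec (2 * n)" for t x
      using that Xc by (simp add: lin[of _ "2*n"] lin[of _ "2*k"] mult_mat_vec_carrier[of _ "2*n" "2*n"])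
    show "X\<^sup>T *\<^sub>v (?J *\<^sub>v (s \<cdot>\<^sub>v u0)) = 0\<^sub>v (2 * k)" "X\<^sup>T *\<^sub>v (?J *\<^sub>v ((s / \<delta>) \<cdot>\<^sub>v v0)) = 0\<^sub>v (2 * k)"
      using u0 v0 by (auto simp: J0 Ju Jv)
    have sc: "(t \<cdot>\<^sub>v x) \<bullet> (A *\<^sub>v (t' \<cdot>\<^sub>v y)) = t * t' * (x \<bullet> (A *\<^sub>v y))"
      if "A \<in> carrier_mat (2 * n) (2 * n)" "x \<in> carrier_vec (2 * n)" "y \<in> carrier_vec (2 * n)"
      for t t' x y and A :: "real mat"
      using that by (simp add: lin[of _ "2*n"])
    show "(s \<cdot>\<^sub>v u0) \<bullet> (?J *\<^sub>v ((s / \<delta>) \<cdot>\<^sub>v v0)) = 1"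
      using a \<delta> s2 unfolding sc[OF sympl_J_carrier u0 v0] uJv by (simp add: field_simps)
    show "\<sigma> * ((s \<cdot>\<^sub>v u0) \<bullet> (M *\<^sub>v (s \<cdot>\<^sub>v u0)) + ((s / \<delta>) \<cdot>\<^sub>v v0) \<bullet> (M *\<^sub>v ((s / \<delta>) \<cdot>\<^sub>v v0)))
        \<le> \<sigma> * (2 * \<delta>)"
      using le unfolding sc[OF M(1) u0 u0] sc[OF M(1) v0 v0] uMu vMv .
  qed (use u0 v0 in auto)
qed

section \<open>Rotation of one eigenvector pair\<close>

text \<open>Of the four terms of the expanded product, orthogonality removes the two mixed ones. The
  factor \<open>c\<close> depends on the column because only one pair of columns is rotated.\<close>

lemma perturbed_congruence_entry:
  fixes A X U :: "real mat"
  assumes A: "A \<in> carrier_mat m m" and X: "X \<in> carrier_mat m q" and U: "U \<in> carrier_mat m q"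
    and orth: "col X i \<bullet> (A *\<^sub>v col U j) = 0" "col U i \<bullet> (A *\<^sub>v col X j) = 0"
    and Y: "Y = mat m q (\<lambda>(r, j). c j * X $$ (r, j) + s * U $$ (r, j))"
    and ij: "i < q" "j < q"
  shows "(Y\<^sup>T * A * Y) $$ (i, j)
    = c i * c j * (X\<^sup>T * A * X) $$ (i, j) + s * s * (col U i \<bullet> (A *\<^sub>v col U j))"
proof -
  have cY: "col Y j = c j \<cdot>\<^sub>v col X j + s \<cdot>\<^sub>v col U j" if "j < q" for j
    using that X U by (intro eq_vecI) (auto simp: Y)
  have carr: "col X j \<in> carrier_vec m" "col U j \<in> carrier_vec m"
    "A *\<^sub>v col X j \<in> carrier_vec m" "A *\<^sub>v col U j \<in> carrier_vec m" if "j < q" for j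
    using that A X U by auto
  have "(Y\<^sup>T * A * Y) $$ (i, j) = col Y i \<bullet> (A *\<^sub>v col Y j)"
    using A ij by (intro congruence_entry) (auto simp: Y)
  also have "A *\<^sub>v col Y j = c j \<cdot>\<^sub>v (A *\<^sub>v col X j) + s \<cdot>\<^sub>v (A *\<^sub>v col U j)"
    using A carr[OF ij(2)] by (simp add: cY[OF ij(2)] mult_add_distrib_mat_vec[of _ m m] mult_mat_vec[of _ m m])
  also have "col Y i \<bullet> (c j \<cdot>\<^sub>v (A *\<^sub>v col X j) + s \<cdot>\<^sub>v (A *\<^sub>v col U j))
      = c i * c j * (col X i \<bullet> (A *\<^sub>v col X j)) + s * s * (col U i \<bullet> (A *\<^sub>v col U j))"
    using carr[OF ij(1)] carr[OF ij(2)] orth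
    by (simp add: cY[OF ij(1)] add_scalar_prod_distrib[of _ m] scalar_prod_add_distrib[of _ m])
  finally show ?thesis
    using A X ij by (simp only: congruence_entry)
qed


lemma sympl_J_antisym:
  assumes "x \<in> carrier_vec (2 * n)" "y \<in> carrier_vec (2 * n)"
  shows "x \<bullet> (sympl_J n *\<^sub>v y) = - (y \<bullet> (sympl_J n *\<^sub>v x))"
proof -
  have "x \<bullet> (sympl_J n *\<^sub>v y) = ((sympl_J n)\<^sup>T *\<^sub>v x) \<bullet> y"
    using assms by (subst transpose_vec_mult_scalar[of _ "2*n" "2*n"]) auto
  also have "\<dots> = - ((sympl_J n *\<^sub>v x) \<bullet> y)"
    using assms by (simp add: sympl_J_transpose)
  also have "(sympl_J n *\<^sub>v x) \<bullet> y = y \<bullet> (sympl_J n *\<^sub>v x)"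
    using assms by (intro comm_scalar_prod[of _ "2*n"]) (auto simp: mult_mat_vec_carrier[of _ "2*n" "2*n"])
  finally show ?thesis .
qed

lemma symmetric_mat_scalar_prod:
  fixes M :: "real mat"
  assumes "M \<in> carrier_mat m m" "M\<^sup>T = M" "x \<in> carrier_vec m" "y \<in> carrier_vec m"
  shows "x \<bullet> (M *\<^sub>v y) = y \<bullet> (M *\<^sub>v x)"
proof -
  have "x \<bullet> (M *\<^sub>v y) = (M\<^sup>T *\<^sub>v x) \<bullet> y"
    using assms by (subst transpose_vec_mult_scalar[of _ m m]) auto
  also have "\<dots> = y \<bullet> (M *\<^sub>v x)"
    using assms by (simp add: comm_scalar_prod[of _ m])
  finally show ?thesis .
qed

lemma sum_two_points:
  fixes a b :: real and p q m :: nat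
  assumes "p < m" "q < m" "p \<noteq> q"
  shows "(\<Sum>j<m. if j = p then a else if j = q then b else 0) = a + b"
proof -
  have "(\<Sum>j<m. if j = p then a else if j = q then b else 0)
      = (\<Sum>j<m. (if j = p then a else 0) + (if j = q then b else 0))"
    using assms(3) by (intro sum.cong) auto
  then show ?thesis
    using assms by (simp add: sum.distrib)
qed

text \<open>\<open>U\<close> carries \<open>u\<close> and \<open>v\<close> in the paired columns
  \<open>p\<close> and \<open>k + p\<close>, and \<open>c\<close> equals cos t there and 1
  elsewhere. Since (u, v) has the same symplectic product as the pair it is mixed with, cos^2 +
  sin^2 = 1 preserves the constraint; the cost changes only in the two diagonal entries of this
  pair.\<close>

lemma rotated_frame:
  assumes M: "M \<in> carrier_mat (2 * n) (2 * n)" "M\<^sup>T = M"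
    and X: "normalized_symplectic_eigenvector_set k n M l X" and p: "p < k"
    and u: "u \<in> carrier_vec (2 * n)" and v: "v \<in> carrier_vec (2 * n)"
    and Xu: "X\<^sup>T *\<^sub>v (sympl_J n *\<^sub>v u) = 0\<^sub>v (2 * k)"
    and Xv: "X\<^sup>T *\<^sub>v (sympl_J n *\<^sub>v v) = 0\<^sub>v (2 * k)"
    and uv: "u \<bullet> (sympl_J n *\<^sub>v v) = 1"
    and U: "U = mat (2 * n) (2 * k) (\<lambda>(r, j). if j = p then u $ r else if j = k + p then v $ r else 0)"
    and c: "c = (\<lambda>j. 1 + of_bool (j = p \<or> j = k + p) * (cos t - 1))"
    and Y: "Y = mat (2 * n) (2 * k) (\<lambda>(r, j). c j * X $$ (r, j) + sin t * U $$ (r, j))"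
  shows "Y \<in> Sp k n"
    and "trace_cost M Y = trace_cost M X
      + (sin t)\<^sup>2 * (u \<bullet> (M *\<^sub>v u) + v \<bullet> (M *\<^sub>v v) - 2 * l (Suc p))"
proof -
  let ?J = "sympl_J n"
  have Xc: "X \<in> carrier_mat (2 * n) (2 * k)" and XJ: "X\<^sup>T * ?J * X = sympl_J k"
    using X by (auto simp: normalized_set_iff Sp_def)
  have Uc: "U \<in> carrier_mat (2 * n) (2 * k)" and Yc: "Y \<in> carrier_mat (2 * n) (2 * k)"
    by (auto simp: U Y)
  have colU: "col U j = (if j = p then u else if j = k + p then v else 0\<^sub>v (2 * n))" if "j < 2 * k" for j
    using that u v by (intro eq_vecI) (auto simp: U)
  have ccol: "col X j \<in> carrier_vec (2 * n)" "col U j \<in> carrier_vec (2 * n)" if "j < 2 * k" for j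
    using that Xc Uc by auto
  have A0: "A *\<^sub>v 0\<^sub>v (2 * n) = 0\<^sub>v (2 * n)" if "A \<in> carrier_mat (2 * n) (2 * n)" for A :: "real mat"
    using that by (intro eq_vecI) auto
  \<comment> \<open>Stated for a general \<open>A\<close>, as it is applied both to J and to
    \<open>M\<close>.\<close>
  have XAU: "col X i \<bullet> (A *\<^sub>v col U j) = 0"
    if ij: "i < 2 * k" "j < 2 * k" and A: "A \<in> carrier_mat (2 * n) (2 * n)"
      and uv: "X\<^sup>T *\<^sub>v (A *\<^sub>v u) = 0\<^sub>v (2 * k)" "X\<^sup>T *\<^sub>v (A *\<^sub>v v) = 0\<^sub>v (2 * k)" for A i j
  proof -
    have "col X i \<bullet> y = (X\<^sup>T *\<^sub>v y) $ i" for y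
      using ij Xc by simp
    then have "col X i \<bullet> (A *\<^sub>v u) = 0" "col X i \<bullet> (A *\<^sub>v v) = 0"
      using ij by (simp_all add: uv)
    then show ?thesis
      using ij A ccol(1)[OF ij(1)] by (auto simp: colU A0)
  qed
  have MXu: "X\<^sup>T *\<^sub>v (M *\<^sub>v x) = 0\<^sub>v (2 * k)"
    if x: "x \<in> carrier_vec (2 * n)" and Xx: "X\<^sup>T *\<^sub>v (?J *\<^sub>v x) = 0\<^sub>v (2 * k)" for x
  proof -
    have "X\<^sup>T *\<^sub>v (M *\<^sub>v x) = (skew_mat k l * (X\<^sup>T * ?J)) *\<^sub>v x"
      using M Xc x unfolding normalized_set_left[OF M X, symmetric]
      by (simp add: assoc_mult_mat_vec[of _ "2*k" "2*n" _ "2*n"])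
    also have "\<dots> = skew_mat k l *\<^sub>v (X\<^sup>T *\<^sub>v (?J *\<^sub>v x))"
      using Xc x by (simp add: assoc_mult_mat_vec[of _ "2*k" "2*n" _ "2*n"]
          assoc_mult_mat_vec[of _ "2*k" "2*k" _ "2*n"] mult_carrier_mat[of _ "2*k" "2*n"])
    also have "\<dots> = 0\<^sub>v (2 * k)"
      unfolding Xx by (rule eq_vecI) auto
    finally show ?thesis .
  qed
  have entryJ: "(Y\<^sup>T * ?J * Y) $$ (i, j)
      = c i * c j * sympl_J k $$ (i, j) + sin t * sin t * (col U i \<bullet> (?J *\<^sub>v col U j))"
    if "i < 2 * k" "j < 2 * k" for i j
    unfolding XJ[symmetric]
  proof (rule perturbed_congruence_entry[OF sympl_J_carrier Xc Uc _ _ Y that])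
    show "col X i \<bullet> (?J *\<^sub>v col U j) = 0"
      by (intro XAU that Xu Xv) auto
    show "col U i \<bullet> (?J *\<^sub>v col X j) = 0"
      unfolding sympl_J_antisym[OF ccol(2)[OF that(1)] ccol(1)[OF that(2)]]
      using XAU[OF that(2,1) sympl_J_carrier Xu Xv] by simp
  qed
  have self: "x \<bullet> (?J *\<^sub>v x) = 0" if "x \<in> carrier_vec (2 * n)" for x
    using sympl_J_antisym[OF that that] by simp
  have vu: "v \<bullet> (?J *\<^sub>v u) = -1"
    using sympl_J_antisym[OF v u] uv by simp
  have cs: "cos t * cos t + sin t * sin t = 1"
    by (metis power2_eq_square sin_cos_squared_add2)
  have "Y\<^sup>T * ?J * Y = sympl_J k"
  proof (rule eq_matI)
    fix i j assume "i < dim_row (sympl_J k)" "j < dim_col (sympl_J k)"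
    then have ij: "i < 2 * k" "j < 2 * k" by auto
    have UJU: "col U i \<bullet> (?J *\<^sub>v col U j)
        = (if i = p \<and> j = k + p then 1 else if i = k + p \<and> j = p then -1 else 0)"
      using ij p u v
      by (auto simp: colU self uv vu A0 scalar_prod_left_zero[OF mult_mat_vec_carrier[OF sympl_J_carrier]])
    have Jk: "sympl_J k $$ (i, j) = (if j = k + i then 1 else if i = k + j then -1 else 0)"
      using ij by (auto simp: sympl_J_def)
    \<comment> \<open>A nonzero entry of \<open>sympl_J k\<close> pairs a column with its partner,
      so its factor \<open>c i * c j\<close> is either 1 or cos^2, and cos^2 arises exactly where
      \<open>U\<close> contributes sin^2.\<close>
    show "(Y\<^sup>T * ?J * Y) $$ (i, j) = sympl_J k $$ (i, j)"
      unfolding entryJ[OF ij] UJU Jk using ij p cs by (auto simp: c algebra_simps)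
  qed (use Yc in auto)
  then show "Y \<in> Sp k n"
    using Yc by (simp add: Sp_def)
  have entryM: "(Y\<^sup>T * M * Y) $$ (i, i)
      = c i * c i * (X\<^sup>T * M * X) $$ (i, i) + sin t * sin t * (col U i \<bullet> (M *\<^sub>v col U i))"
    if "i < 2 * k" for i
  proof (rule perturbed_congruence_entry[OF M(1) Xc Uc _ _ Y that that])
    show *: "col X i \<bullet> (M *\<^sub>v col U i) = 0"
      by (intro XAU that MXu u v Xu Xv M)
    show "col U i \<bullet> (M *\<^sub>v col X i) = 0"
      unfolding symmetric_mat_scalar_prod[OF M ccol(2)[OF that] ccol(1)[OF that]] by (rule *)
  qed
  \<comment> \<open>The rotated entries have the form cos^2 \<lambda> + sin^2 x = \<lambda> + sin^2
    (x - \<lambda>), where \<lambda> is \<open>l (Suc p)\<close> and x the cost of \<open>u\<close>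
    or \<open>v\<close>.\<close>
  have "(Y\<^sup>T * M * Y) $$ (i, i) = (X\<^sup>T * M * X) $$ (i, i)
      + (if i = p then (sin t)\<^sup>2 * (u \<bullet> (M *\<^sub>v u) - l (Suc p))
         else if i = k + p then (sin t)\<^sup>2 * (v \<bullet> (M *\<^sub>v v) - l (Suc p)) else 0)"
    if i: "i < 2 * k" for i
  proof -
    have cs': "cos t * (cos t * x) + sin t * (sin t * x) = x" for x
      by (metis cs distrib_right mult.assoc mult_1)
    have "(X\<^sup>T * M * X) $$ (i, i) = doubled k l i"
      using i by (simp add: normalized_set_congruence[OF M(1) X] mat_diag_def)
    then show ?thesis
      unfolding entryM[OF i] using i p M
      by (auto simp: colU A0 c doubled_def power2_eq_square algebra_simps cs')
  qed
  then have "trace_cost M Y = (\<Sum>i<2 * k. (X\<^sup>T * M * X) $$ (i, i)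
      + (if i = p then (sin t)\<^sup>2 * (u \<bullet> (M *\<^sub>v u) - l (Suc p))
         else if i = k + p then (sin t)\<^sup>2 * (v \<bullet> (M *\<^sub>v v) - l (Suc p)) else 0))"
    using Yc by (simp add: trace_cost_def mat_trace_def)
  also have "\<dots> = trace_cost M X + ((sin t)\<^sup>2 * (u \<bullet> (M *\<^sub>v u) - l (Suc p))
      + (sin t)\<^sup>2 * (v \<bullet> (M *\<^sub>v v) - l (Suc p)))"
    using Xc p by (simp only: sum.distrib) (subst sum_two_points, auto simp: trace_cost_def mat_trace_def)
  finally show "trace_cost M Y = trace_cost M X
      + (sin t)\<^sup>2 * (u \<bullet> (M *\<^sub>v u) + v \<bullet> (M *\<^sub>v v) - 2 * l (Suc p))"
    by (simp add: algebra_simps)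
qed

section \<open>Descent and ascent in every neighbourhood\<close>

text \<open>A rotation by a small angle stays within \<epsilon> by continuity, and its effect on the
  cost is sin^2 t times a factor whose sign is fixed by the strict gap between \<delta> and
  \<open>l (Suc p)\<close>.\<close>

lemma normalized_set_not_extremal:
  assumes M: "M \<in> carrier_mat (2 * n) (2 * n)" "M\<^sup>T = M"
    and X: "normalized_symplectic_eigenvector_set k n M l X"
    and T: "normalized_symplectic_eigenvector_set k n M \<mu> T"
    and p: "p < k" "0 < l (Suc p)"
    and \<mu>: "\<And>a. a \<in> {1..k} \<Longrightarrow> 0 < \<mu> a \<and> \<sigma> * \<mu> a \<le> \<sigma> * \<delta>"
    and \<delta>: "0 < \<delta>" "\<sigma> * \<delta> < \<sigma> * l (Suc p)"
    and \<epsilon>: "0 < \<epsilon>"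
  shows "\<exists>Y \<in> Sp k n. frob_dist X Y < \<epsilon> \<and> \<sigma> * trace_cost M Y < \<sigma> * trace_cost M X"
proof -
  obtain u v where u: "u \<in> carrier_vec (2 * n)" and v: "v \<in> carrier_vec (2 * n)"
    and orth: "X\<^sup>T *\<^sub>v (sympl_J n *\<^sub>v u) = 0\<^sub>v (2 * k)" "X\<^sup>T *\<^sub>v (sympl_J n *\<^sub>v v) = 0\<^sub>v (2 * k)"
      "u \<bullet> (sympl_J n *\<^sub>v v) = 1"
    and le: "\<sigma> * (u \<bullet> (M *\<^sub>v u) + v \<bullet> (M *\<^sub>v v)) \<le> \<sigma> * (2 * \<delta>)"
  proof (rule symplectic_direction[OF M X T p(1,2) _ \<delta>(1), of \<sigma>])
    \<comment> \<open>The gap forces \<sigma> \<mu> < \<sigma> \<open>l (Suc p)\<close>, hence the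
      two values are distinct.\<close>
    show "0 < \<mu> a \<and> \<mu> a \<noteq> l (Suc p) \<and> \<sigma> * \<mu> a \<le> \<sigma> * \<delta>" if "a \<in> {1..k}" for a
      using \<mu>[OF that] \<delta>(2) by auto
  qed
  define U where "U = mat (2 * n) (2 * k) (\<lambda>(r, j). if j = p then u $ r else if j = k + p then v $ r else 0)"
  define c where "c t = (\<lambda>j. 1 + of_bool (j = p \<or> j = k + p) * (cos t - 1))" for t :: real
  define Y where "Y t = mat (2 * n) (2 * k) (\<lambda>(r, j). c t j * X $$ (r, j) + sin t * U $$ (r, j))" for t
  note Y = rotated_frame[OF M X p(1) u v orth U_def c_def Y_def]
  have Xc: "X \<in> carrier_mat (2 * n) (2 * k)"
    using X by (auto simp: normalized_set_iff Sp_def)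
  have dist: "frob_dist X (Y t) = sqrt (\<Sum>r<2 * n. \<Sum>j<2 * k.
      (X $$ (r, j) - (c t j * X $$ (r, j) + sin t * U $$ (r, j)))\<^sup>2)" for t
    using Xc by (auto simp: frob_dist_def Y_def intro!: arg_cong[where f = sqrt] sum.cong)
  have "isCont (\<lambda>t. frob_dist X (Y t)) 0"
    unfolding dist c_def by (intro continuous_intros)
  moreover have "frob_dist X (Y 0) = 0"
    by (simp add: dist c_def)
  ultimately have "(\<lambda>t. frob_dist X (Y t)) \<midarrow>0\<rightarrow> 0"
    by (simp add: isCont_def)
  from LIM_D[OF this \<epsilon>] obtain s where s: "s > 0"
    and near: "\<And>t. t \<noteq> 0 \<and> norm (t - 0) < s \<Longrightarrow> norm (frob_dist X (Y t) - 0) < \<epsilon>"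
    by blast
  \<comment> \<open>Below \<open>s\<close> the distance stays under \<epsilon>; the cap 1 keeps
    \<open>t\<close> in the range (0, 2), where the sine is positive.\<close>
  define t where "t = min (s / 2) 1"
  have t: "0 < t" "t < s" "t < 2"
    using s by (auto simp: t_def)
  have "frob_dist X (Y t) < \<epsilon>"
    using near[of t] t by simp
  moreover have "\<sigma> * trace_cost M (Y t) < \<sigma> * trace_cost M X"
  proof -
    have "0 < (sin t)\<^sup>2"
      using sin_gt_zero_02[OF t(1,3)] by simp
    moreover have "\<sigma> * (u \<bullet> (M *\<^sub>v u) + v \<bullet> (M *\<^sub>v v) - 2 * l (Suc p)) < 0"
      using le \<delta>(2) by (simp add: algebra_simps)
    ultimately have "(sin t)\<^sup>2 * (\<sigma> * (u \<bullet> (M *\<^sub>v u) + v \<bullet> (M *\<^sub>v v) - 2 * l (Suc p))) < 0"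
      by (rule mult_pos_neg)
    then show ?thesis
      unfolding Y(2) by (simp add: algebra_simps)
  qed
  ultimately show ?thesis
    using Y(1) by blast
qed

theorem proposition4p12:
  fixes n k :: nat and M X :: "real mat" and d :: "nat \<Rightarrow> real" and i :: "nat \<Rightarrow> nat"
  assumes "sym_pos_def (2 * n) M"
    and "symplectic_eigenvalues n M d"
    and "1 \<le> k" and "k \<le> n"
    and "strict_mono_on {1..k} i" and "i ` {1..k} \<subseteq> {1..n}"
    and "normalized_symplectic_eigenvector_set k n M (\<lambda>j. d (i j)) X"
    and "\<exists>j \<in> {1..k}. d k < d (i j) \<and> d (i j) < d (n - k + 1)"
  shows "saddle_point k n M X"
proof -
  have M: "M \<in> carrier_mat (2 * n) (2 * n)" "M\<^sup>T = M"
    using assms(1) by (auto simp: sym_pos_def_def)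
  note X = assms(7)
  have pos: "0 < d a" if "a \<in> {1..n}" for a
    using assms(2) that by (auto simp: symplectic_eigenvalues_def)
  have mono: "d a \<le> d b" if "a \<in> {1..n}" "b \<in> {1..n}" "a \<le> b" for a b
    using assms(2) that by (auto simp: symplectic_eigenvalues_def mono_on_def)
  obtain S where S: "S \<in> Sp n n" "S\<^sup>T * M * S = mat_diag (2 * n) (doubled n d)"
    using assms(2) by (auto simp: symplectic_eigenvalues_def doubled_diag)
  have NS: "normalized_symplectic_eigenvector_set n n M d S"
    by (rule normalized_set_of_williamson[OF M(1) S])
  obtain j where j: "j \<in> {1..k}" "d k < d (i j)" "d (i j) < d (n - k + 1)"
    using assms(8) by blast
  \<comment> \<open>Columns are counted from 0, the chosen eigenvalues from 1.\<close>
  define p where "p = j - 1"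
  have p: "p < k" "Suc p = j"
    using j by (auto simp: p_def)
  have lpos: "0 < d (i (Suc p))"
    unfolding p(2) using j assms(6) by (intro pos) blast
  have "critical_point k n M X"
    using X unfolding normalized_set_iff critical_point_def
    by (auto intro!: bexI[of _ "skew_mat k (\<lambda>j. d (i j))"] simp: skew_mat_transpose)
  moreover have "\<not> local_minimizer_on (Sp k n) (trace_cost M) X"
  proof -
    \<comment> \<open>Eigenvector pairs for the \<open>k\<close> smallest values, which are bounded
      above by \<delta> = \<open>d k\<close>; for \<open>a\<close> in {1..k},
      \<open>Suc (a - 1)\<close> is just \<open>a\<close>. Here \<sigma> = 1.\<close>
    obtain T where T: "normalized_symplectic_eigenvector_set k n M (\<lambda>a. d (Suc (a - 1))) T"
      using normalized_set_select[OF M(1) NS, where k = k and h = "\<lambda>r. r"] assms(4) by auto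
    have bound: "0 < d (Suc (a - 1)) \<and> 1 * d (Suc (a - 1)) \<le> 1 * d k" if "a \<in> {1..k}" for a
      using that assms(4) pos[of "Suc (a - 1)"] mono[of "Suc (a - 1)" k] by auto
    have "\<exists>Y \<in> Sp k n. frob_dist X Y < \<epsilon> \<and> 1 * trace_cost M Y < 1 * trace_cost M X" if "0 < \<epsilon>" for \<epsilon>
      using that j(2) pos[of k] assms(3,4) p
      by (intro normalized_set_not_extremal[OF M X T p(1) lpos bound]) auto
    then show ?thesis
      by (force simp: local_minimizer_on_def not_le)
  qed
  moreover have "\<not> local_maximizer_on (Sp k n) (trace_cost M) X"
  proof -
    \<comment> \<open>Eigenvector pairs for the indices n - k + 1, ..., n, whose values are bounded
      below by \<delta> = \<open>d (n - k + 1)\<close>. Taking \<sigma> = -1 reverses all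
      inequalities, so descent becomes ascent.\<close>
    obtain T where T: "normalized_symplectic_eigenvector_set k n M (\<lambda>a. d (Suc (n - k + (a - 1)))) T"
      using normalized_set_select[OF M(1) NS, where k = k and h = "\<lambda>r. n - k + r"] assms(4)
      by (force simp: inj_on_def)
    have bound: "0 < d (Suc (n - k + (a - 1)))
        \<and> -1 * d (Suc (n - k + (a - 1))) \<le> -1 * d (n - k + 1)" if "a \<in> {1..k}" for a
      using that assms(4) pos[of "Suc (n - k + (a - 1))"]
        mono[of "n - k + 1" "Suc (n - k + (a - 1))"] by auto
    have "\<exists>Y \<in> Sp k n. frob_dist X Y < \<epsilon> \<and> -1 * trace_cost M Y < -1 * trace_cost M X" if "0 < \<epsilon>" for \<epsilon>
      using that j(3) pos[of "n - k + 1"] assms(3,4) p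
      by (intro normalized_set_not_extremal[OF M X T p(1) lpos bound]) auto
    then show ?thesis
      by (force simp: local_maximizer_on_def not_le)
  qed
  ultimately show ?thesis
    by (simp add: saddle_point_def)
qed

end
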